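(* Let $c\ge d\ge1$ be integers, let $G$ be a $(c+1,d+1)$-regular bipartite graph with vertex set $V\cup W$, $|V|=n$, $|W|=m$, and let the $n\times m$ matrix $A$ be a generalized adjacency matrix for $G$. Then for all $k\ge1$, $$\sum_\gamma A_2(\gamma)=\mathrm{Tr}\left[2\widetilde T_k(AA^* )+s_{c,d,k}I\right],$$ where the sum is over all closed non-backtracking tailless paths $\gamma$ of length $2k$ in $G$ that start with a vertex in $V$, $I$ is the $n\times n$ identity matrix, and $$s_{c,d,k}=\frac{(c-d)(-d)^k+cd-1}{d+1}.$$
   Context: Graphs are finite and simple. A bipartite graph with vertex classes $V$ and $W$ has edges only between $V$ and $W$. It is $(c+1,d+1)$-regular if every vertex in $V$ is connected to $c+1$ vertices in $W$ and every vertex in $W$ is connected to $d+1$ vertices in $V$. A generalized adjacency matrix for it is a complex $n\times m$ matrix $A$, rows indexed by $V$ and columns by $W$, with $|A_{vw}|=1$ if $(v,w)$ is an edge and $A_{vw}=0$ otherwise. A path of length $L$ is a sequence of vertices $(u_0,\dots,u_L)$ with consecutive vertices adjacent. It is non-backtracking if $u_{j+1}\ne u_{j-1}$ for all $1\le j\le L-1$; closed if $u_L=u_0$. A closed path is non-backtracking tailless if it is non-backtracking and $u_{L-1}\ne u_1$. (Paths are sequences, so different starting points or orientations give different paths.) For a path $\gamma=(v_0,w_1,v_1,\dots,w_k,v_k)$ with $v_i\in V$, $w_i\in W$, $$A_2(\gamma):=A_{v_0w_1}\overline{A_{v_1w_1}}\,A_{v_1w_2}\overline{A_{v_2w_2}}\cdots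 A_{v_{k-1}w_k}\overline{A_{v_kw_k}}.$$ $\widetilde T_k(x):=(cd)^{k/2}\,T_k\!\left(\frac{x-(c+d)}{2\sqrt{cd}}\right)$, where $T_k(\cos\theta)=\cos k\theta$ is the Chebyshev polynomial of the first kind. *)

theory Defs
  imports
    "HOL-Analysis.Analysis"
    "HOL-Computational_Algebra.Polynomial"
    "Graph_Theory.Pair_Digraph"
    "Graph_Theory.Vertex_Walk"
begin

text \<open>
  Finite simple graphs are \<^locale>\<open>pair_graph\<close>s: finite, loop-free and symmetric, so an
  undirected edge between \<open>x\<close> and \<open>y\<close> is the pair of arcs \<open>(x, y)\<close> and \<open>(y, x)\<close>.
  The vertex classes \<open>V\<close> and \<open>W\<close> of a bipartite graph are the types \<open>'v\<close> and \<open>'w\<close>; their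
  disjoint union \<open>'v + 'w\<close> is the vertex set, so that matrices with rows indexed by \<open>V\<close> and
  columns indexed by \<open>W\<close> have type \<open>complex ^ 'w ^ 'v\<close>.
\<close>

definition bipartite_graph :: "('v + 'w) pair_pre_digraph \<Rightarrow> bool" where
  "bipartite_graph G \<longleftrightarrow>
     pair_graph G \<and> pverts G = UNIV \<and>
     (\<forall>x y. x \<rightarrow>\<^bsub>G\<^esub> y \<longrightarrow>
        (x \<in> range Inl \<and> y \<in> range Inr) \<or> (x \<in> range Inr \<and> y \<in> range Inl))"

definition biregular :: "('v + 'w) pair_pre_digraph \<Rightarrow> nat \<Rightarrow> nat \<Rightarrow> bool" where
  "biregular G a b \<longleftrightarrow>
     (\<forall>v. card {w. Inl v \<rightarrow>\<^bsub>G\<^esub> Inr w} = a) \<and> (\<forall>w. card {v. Inr w \<rightarrow>\<^bsub>G\<^esub> Inl v} = b)"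

definition gen_adjacency_matrix ::
    "('v + 'w) pair_pre_digraph \<Rightarrow> complex ^ 'w ^ 'v \<Rightarrow> bool" where
  "gen_adjacency_matrix G A \<longleftrightarrow>
     (\<forall>v w. if Inl v \<rightarrow>\<^bsub>G\<^esub> Inr w then norm (A $ v $ w) = 1 else A $ v $ w = 0)"


text \<open>A path \<open>(u\<^sub>0, \<dots>, u\<^sub>L)\<close> is the list of its \<open>L + 1\<close> vertices.\<close>

definition path_of_length :: "'a pair_pre_digraph \<Rightarrow> nat \<Rightarrow> 'a list \<Rightarrow> bool" where
  "path_of_length G L p \<longleftrightarrow> vwalk p G \<and> vwalk_length p = L"

definition non_backtracking :: "'a list \<Rightarrow> bool" where
  "non_backtracking p \<longleftrightarrow> (\<forall>j. 1 \<le> j \<and> j + 1 \<le> vwalk_length p \<longrightarrow> p ! (j + 1) \<noteq> p ! (j - 1))"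

definition closed_path :: "'a list \<Rightarrow> bool" where
  "closed_path p \<longleftrightarrow> p ! vwalk_length p = p ! 0"

text \<open>Only meaningful for closed paths of positive length.\<close>

definition tailless :: "'a list \<Rightarrow> bool" where
  "tailless p \<longleftrightarrow> p ! (vwalk_length p - 1) \<noteq> p ! 1"

definition closed_nbt_paths_from_V :: "('v + 'w) pair_pre_digraph \<Rightarrow> nat \<Rightarrow> ('v + 'w) list set" where
  "closed_nbt_paths_from_V G L =
     {p. path_of_length G L p \<and> closed_path p \<and> non_backtracking p \<and> tailless p \<and>
         p ! 0 \<in> range Inl}"

text \<open>
  For \<open>p = (v\<^sub>0, w\<^sub>1, v\<^sub>1, \<dots>, w\<^sub>k, v\<^sub>k)\<close> the vertex \<open>v\<^sub>i\<close> sits at position \<open>2 i\<close> and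
  \<open>w\<^sub>i\<close> at position \<open>2 i - 1\<close>. The value is meaningful for paths of even length in a bipartite
  graph that start in \<open>V\<close>.
\<close>

definition A2 :: "complex ^ 'w ^ 'v \<Rightarrow> ('v + 'w) list \<Rightarrow> complex" where
  "A2 A p = (\<Prod>i = 1..vwalk_length p div 2.
     A $ projl (p ! (2 * (i - 1))) $ projr (p ! (2 * i - 1)) *
     cnj (A $ projl (p ! (2 * i)) $ projr (p ! (2 * i - 1))))"


definition conj_transpose :: "complex ^ 'w ^ 'v \<Rightarrow> complex ^ 'v ^ 'w" where
  "conj_transpose A = (\<chi> w v. cnj (A $ v $ w))"

text \<open>On the type of matrices \<open>*\<close> and \<open>^\<close> would act componentwise, hence a separate power.\<close>

primrec matrix_power :: "'a :: semiring_1 ^ 'n ^ 'n \<Rightarrow> nat \<Rightarrow> 'a ^ 'n ^ 'n" where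
  "matrix_power M 0 = mat 1"
| "matrix_power M (Suc i) = M ** matrix_power M i"

definition poly_matrix :: "real poly \<Rightarrow> complex ^ 'n ^ 'n \<Rightarrow> complex ^ 'n ^ 'n" where
  "poly_matrix p M = (\<Sum>i\<le>degree p. coeff p i *\<^sub>R matrix_power M i)"


definition chebyshev_T :: "nat \<Rightarrow> real poly" where
  "chebyshev_T k = (THE p. \<forall>\<theta>. poly p (cos \<theta>) = cos (real k * \<theta>))"

definition chebyshev_T_tilde :: "nat \<Rightarrow> nat \<Rightarrow> nat \<Rightarrow> real poly" where
  "chebyshev_T_tilde c d k =
     smult (real (c * d) powr (real k / 2))
       (chebyshev_T k \<circ>\<^sub>p
          [: - real (c + d) / (2 * sqrt (real (c * d))), 1 / (2 * sqrt (real (c * d))) :])"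

definition s_const :: "nat \<Rightarrow> nat \<Rightarrow> nat \<Rightarrow> real" where
  "s_const c d k =
     ((real c - real d) * (- real d) ^ k + real c * real d - 1) / (real d + 1)"


text \<open>The description defining \<^const>\<open>chebyshev_T\<close> is proper.\<close>

lemma chebyshev_poly_unique:
  fixes p q :: "real poly"
  assumes "\<And>\<theta>. poly p (cos \<theta>) = poly q (cos \<theta>)"
  shows "p = q"
proof (rule ccontr)
  assume "p \<noteq> q"
  hence "finite {x. poly (p - q) x = 0}"
    by (intro poly_roots_finite) simp
  moreover have "{-1..1} \<subseteq> {x. poly (p - q) x = 0}"
  proof
    fix x :: real assume "x \<in> {-1..1}"
    with assms[of "arccos x"] show "x \<in> {x. poly (p - q) x = 0}"
      by (simp add: cos_arccos)
  qed
  ultimately have "finite {-1..1::real}"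
    using finite_subset by blast
  thus False using infinite_Icc[of "-1" "1::real"] by simp
qed

lemma chebyshev_poly_exists:
  "\<exists>p::real poly. \<forall>\<theta>. poly p (cos \<theta>) = cos (real k * \<theta>)"
proof (induction k rule: induct_nat_012)
  case 0
  show ?case by (rule exI[of _ 1]) simp
next
  case 1
  show ?case by (rule exI[of _ "[:0, 1:]"]) simp
next
  case (ge2 n)
  then obtain p q :: "real poly"
    where p: "\<And>\<theta>. poly p (cos \<theta>) = cos (real n * \<theta>)"
      and q: "\<And>\<theta>. poly q (cos \<theta>) = cos (real (Suc n) * \<theta>)" by blast
  have "poly ([:0, 2:] * q - p) (cos \<theta>) = cos (real (Suc (Suc n)) * \<theta>)" for \<theta>
  proof -
    have "cos (real (Suc n) * \<theta> + \<theta>) + cos (real (Suc n) * \<theta> - \<theta>) =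
        2 * cos \<theta> * cos (real (Suc n) * \<theta>)"
      unfolding cos_add cos_diff by (simp add: algebra_simps)
    moreover have "real (Suc n) * \<theta> + \<theta> = real (Suc (Suc n)) * \<theta>"
      and "real (Suc n) * \<theta> - \<theta> = real n * \<theta>" by (simp_all add: algebra_simps)
    ultimately show ?thesis by (simp add: p q)
  qed
  thus ?case by blast
qed

lemma poly_chebyshev_T_cos: "poly (chebyshev_T k) (cos \<theta>) = cos (real k * \<theta>)"
proof -
  have "\<exists>!p::real poly. \<forall>\<theta>. poly p (cos \<theta>) = cos (real k * \<theta>)"
    using chebyshev_poly_exists[of k] by (metis chebyshev_poly_unique)
  from theI'[OF this] show ?thesis
    unfolding chebyshev_T_def by blast
qed

end

theory Submission
  imports Defs
begin

text \<open>
  Cut a closed path \<open>(v\<^sub>0, w\<^sub>1, v\<^sub>1, \<dots>, w\<^sub>k, v\<^sub>k)\<close> into the edges \<open>(v\<^sub>i\<^sub>-\<^sub>1, w\<^sub>i)\<close>. Passing from one of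
  these edges to the next is a turn at \<open>w\<^sub>i\<close> to another edge, followed by a turn at \<open>v\<^sub>i\<close>. With
  \<open>b\<close> and \<open>a\<close> for the weighted matrices of the two kinds of turn, indexed by edges, and
  \<open>N = b a\<close>, the sum over paths is therefore \<open>Tr N\<^sup>k\<close>; being closed, non-backtracking and tailless
  is exactly a cyclic condition on the edges (\<open>sum_closed_paths_eq_trace\<close>). What remains is an
  identity about traces of words in \<open>a\<close> and \<open>b\<close>.

  Let \<open>X\<close> be the incidence matrix of edges and \<open>V\<close>, and \<open>Y\<close> a weighted one of edges and \<open>W\<close>,
  with \<open>X\<^sup>* Y = A\<close>. On edges, \<open>a = X X\<^sup>* - 1\<close> and \<open>b = Y Y\<^sup>* - 1\<close>, and regularity gives
  \<open>a\<^sup>2 = (c - 1) a + c\<close> and \<open>b\<^sup>2 = (d - 1) b + d\<close> (\<open>turn_square\<close>). Two consequences are played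
  off against each other.

  First, \<open>X\<^sup>* N\<^sup>k\<close> satisfies the three-term recursion of the rescaled Chebyshev polynomials
  in \<open>A A\<^sup>*\<close> (\<open>star_N_recursion\<close>). Hence so does \<open>Q\<^sub>k = X\<^sup>* N\<^sup>k X\<close>, and comparing initial values
  expresses \<open>Q\<^sub>k\<^sub>+\<^sub>2 - c d Q\<^sub>k\<close> through the matrices \<open>D\<^sub>k\<close>, twice the \<open>k\<close>-th rescaled Chebyshev
  polynomial in \<open>A A\<^sup>*\<close> (\<open>Q_eq_D\<close>).

  Second, \<open>Tr Q\<^sub>k\<close> counts all closed non-backtracking paths, with or without tail, up to the factor
  \<open>c\<close>. By cyclicity of the trace and the quadratic relations, which strip a tail one edge
  at a time (\<open>alpha_Suc\<close>, \<open>beta_Suc\<close>), \<open>Tr (Q\<^sub>k\<^sub>+\<^sub>2 - c d Q\<^sub>k)\<close> is a combination of the numbers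
  \<open>Tr N\<^sup>j\<close> alone, and it is the same combination as in the first consequence. So
  \<open>Tr N\<^sup>k - Tr D\<^sub>k\<close> satisfies a recursion with constant coefficients and the characteristic roots
  \<open>1\<close> and \<open>- d\<close>; its values at \<open>1\<close> and \<open>2\<close> single out \<open>n s\<^sub>c\<^sub>,\<^sub>d\<^sub>,\<^sub>k\<close> (\<open>trace_N_power\<close>).
\<close>

section \<open>Matrices as a ring with a trace\<close>

lemma matrix_mult_distribs:
  fixes A A' :: "'a::real_algebra_1 ^ 'm ^ 'n" and B B' :: "'a ^ 'l ^ 'm"
  shows "A ** (B + B') = A ** B + A ** B'" "A ** (B - B') = A ** B - A ** B'"
    and "(A + A') ** B = A ** B + A' ** B" "(A - A') ** B = A ** B - A' ** B"
    and "A ** (r *\<^sub>R B) = r *\<^sub>R (A ** B)" "(r *\<^sub>R A) ** B = r *\<^sub>R (A ** B)"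
  by (simp_all add: matrix_matrix_mult_def vec_eq_iff sum.distrib sum_subtractf
      scaleR_sum_right algebra_simps)

lemma matrix_mult_sum_right:
  fixes A :: "'a::real_algebra_1 ^ 'm ^ 'n"
  shows "A ** (\<Sum>i\<in>I. B i) = (\<Sum>i\<in>I. A ** B i)"
  by (induction I rule: infinite_finite_induct)
    (simp_all add: matrix_add_ldistrib vec_eq_iff matrix_matrix_mult_def sum.distrib distrib_left)

lemma trace_scaleR: "trace (r *\<^sub>R A) = r *\<^sub>R trace A"
  for A :: "'a::real_algebra_1 ^ 'n ^ 'n"
  by (simp add: trace_def scaleR_sum_right)

lemmas matrix_trace_simps = trace_add trace_sub trace_scaleR

lemma matrix_power_commute: "matrix_power M k ** M = M ** matrix_power M k"
  for M :: "'a::real_algebra_1 ^ 'n ^ 'n"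
  by (induction k) (simp_all flip: matrix_mul_assoc)

section \<open>Traces of the non-backtracking operator\<close>

text \<open>
  Think of \<open>'e\<close> as containing the edges, of \<open>p\<close> as the projection onto the functions supported
  on edges, and of \<open>X\<close> as a weighted incidence matrix between edges and one vertex class, with
  adjoint \<open>Xs\<close>. That every vertex of the class has degree \<open>c + 1\<close> is the first assumption. The
  projection allows \<open>'e\<close> to be the type of all pairs of a vertex in \<open>V\<close> and one in \<open>W\<close>.
\<close>

locale incidence_operator =
  fixes X :: "complex ^ 'v::finite ^ 'e::finite" and Xs :: "complex ^ 'e ^ 'v"
    and p :: "complex ^ 'e ^ 'e" and c :: real
  assumes star_mult: "Xs ** X = (c + 1) *\<^sub>R mat 1"
    and proj: "p ** p = p" "p ** X = X" "Xs ** p = Xs"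
begin

text \<open>
  The operator \<open>X ** Xs\<close> passes from an edge to any edge at the same vertex. Removing \<open>p\<close> forbids
  the edge itself: this is the non-backtracking condition at one vertex.
\<close>

definition turn :: "complex ^ 'e ^ 'e" where
  "turn = X ** Xs - p"

lemma turn_absorbs: "p ** turn = turn" "turn ** p = turn"
  by (simp_all add: turn_def matrix_mult_distribs matrix_mul_assoc proj)
    (simp_all add: proj flip: matrix_mul_assoc)

lemma star_turn: "Xs ** turn = c *\<^sub>R Xs"
  by (simp add: turn_def matrix_mult_distribs matrix_mul_assoc proj star_mult algebra_simps)

lemma incidence_mult_star: "X ** Xs = turn + p"
  by (simp add: turn_def)

text \<open>
  Turning twice at a vertex of degree \<open>c + 1\<close> returns to the first edge in \<open>c\<close> ways and ends at
  any given other edge in \<open>c - 1\<close> ways.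
\<close>

lemma turn_square: "turn ** turn = (c - 1) *\<^sub>R turn + c *\<^sub>R p"
proof -
  have "turn ** turn = X ** (Xs ** turn) - p ** turn"
    by (simp add: turn_def matrix_mult_distribs matrix_mul_assoc)
  also have "\<dots> = c *\<^sub>R (turn + p) - turn"
    by (simp add: star_turn turn_absorbs matrix_mult_distribs incidence_mult_star)
  finally show ?thesis by (simp add: algebra_simps)
qed

end

text \<open>
  Both vertex classes act on the same edges. In a graph the traces vanish because no edge is
  reached from itself by a turn at one end, or by a turn at one end and then one at the other.
\<close>

locale biregular_operators =
  V: incidence_operator X Xs p c + W: incidence_operator Y Ys p d
  for X :: "complex ^ 'v::finite ^ 'e::finite" and Xs :: "complex ^ 'e ^ 'v"
    and Y :: "complex ^ 'w::finite ^ 'e::finite" and Ys :: "complex ^ 'e ^ 'w"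
    and p :: "complex ^ 'e ^ 'e" and c d :: real +
  assumes traces: "trace V.turn = 0" "trace W.turn = 0" "trace (W.turn ** V.turn) = 0"
    and c_nonzero: "c \<noteq> 0"
begin

abbreviation "a \<equiv> V.turn"
abbreviation "b \<equiv> W.turn"

text \<open>
  A power of \<open>N\<close> alternates turns at the two ends of an edge, so it runs through the
  non-backtracking walks, and its trace runs through the closed tailless ones.
\<close>

definition N :: "complex ^ 'e ^ 'e" where "N = b ** a"

text \<open>
  Since \<open>Xs ** Y\<close> is the biadjacency matrix \<open>A\<close> in the graph case, \<open>M\<close> plays the role of
  \<open>A A\<^sup>*\<close>, and \<open>H\<close> is the numerator of the argument at which the Chebyshev polynomials are
  evaluated.
\<close>

definition M :: "complex ^ 'v ^ 'v" where "M = Xs ** Y ** Ys ** X"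

definition H :: "complex ^ 'v ^ 'v" where "H = M - (c + d) *\<^sub>R mat 1"

lemma star_W_turn_incidence: "Xs ** b ** X = M - (c + 1) *\<^sub>R mat 1"
  by (simp add: W.turn_def M_def matrix_mult_distribs matrix_mul_assoc V.proj V.star_mult)

text \<open>
  Splitting \<open>X ** Xs\<close> in \<open>M ** Xs = Xs ** Y ** Ys ** (X ** Xs)\<close> into turn and projection
  expresses one step of \<open>N\<close> through \<open>M\<close>, up to the half step \<open>Xs ** b\<close>.
\<close>

lemma star_N:
  "Xs ** N = H ** Xs + (d - 1) *\<^sub>R Xs - Xs ** b"
proof -
  have "M ** Xs - (c + 1) *\<^sub>R Xs = Xs ** b ** (X ** Xs)"
    unfolding matrix_mul_assoc star_W_turn_incidence by (simp add: matrix_mult_distribs)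
  also have "\<dots> = Xs ** N + Xs ** b"
    unfolding V.incidence_mult_star
    by (simp add: matrix_mult_distribs N_def matrix_mul_assoc)
      (simp add: W.turn_absorbs flip: matrix_mul_assoc)
  finally show ?thesis
    by (simp add: H_def matrix_mult_distribs algebra_simps)
qed

text \<open>
  Multiplying the previous identity by \<open>b\<close> and then by \<open>a\<close> removes the half step: the quadratic
  relation for \<open>b\<close> cancels the term with factor \<open>d - 1\<close>, and \<open>Xs ** a = c Xs\<close> closes the
  recursion. This is the three-term recursion of the rescaled Chebyshev polynomials.
\<close>

lemma star_N_recursion:
  "Xs ** matrix_power N (Suc (Suc k)) =
     H ** (Xs ** matrix_power N (Suc k)) - (c * d) *\<^sub>R (Xs ** matrix_power N k)"
proof -
  have bb: "Xs ** b ** b = (d - 1) *\<^sub>R (Xs ** b) + d *\<^sub>R Xs"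
    unfolding matrix_mul_assoc[symmetric] W.turn_square
    by (simp add: matrix_mult_distribs V.proj)
  have "Xs ** N ** N = (Xs ** N ** b) ** a" by (simp add: N_def matrix_mul_assoc)
  also have "Xs ** N ** b = H ** Xs ** b - d *\<^sub>R Xs"
    unfolding star_N by (simp add: matrix_mult_distribs bb)
  also have "\<dots> ** a = H ** (Xs ** N) - (c * d) *\<^sub>R Xs"
    by (simp add: matrix_mult_distribs N_def matrix_mul_assoc V.star_turn mult.commute)
  finally have "(Xs ** N ** N) ** matrix_power N k =
      (H ** (Xs ** N) - (c * d) *\<^sub>R Xs) ** matrix_power N k" by simp
  thus ?thesis by (simp add: matrix_mult_distribs matrix_mul_assoc)
qed

text \<open>
  The numbers \<open>tau\<close> are the wanted traces. The numbers \<open>alpha\<close> and \<open>beta\<close> are traces of words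
  with one turn more, in which two equal letters are adjacent cyclically; they collect the closed
  non-backtracking paths with a tail.
\<close>

definition tau where "tau k = trace (matrix_power N k)"
definition alpha where "alpha k = trace (a ** matrix_power N k)"
definition beta where "beta k = trace (matrix_power N k ** b)"

lemma N_absorbs: "p ** N = N" "N ** p = N"
  by (simp_all add: N_def matrix_mul_assoc W.turn_absorbs)
    (simp add: V.turn_absorbs flip: matrix_mul_assoc)

text \<open>
  Cyclically the word contains \<open>a ** a\<close>, and the quadratic relation shortens it: this is the
  removal of the tail of a closed path.
\<close>

lemma alpha_Suc: "alpha (Suc k) = (c - 1) *\<^sub>R tau (Suc k) + c *\<^sub>R beta k"
proof -
  have "alpha (Suc k) = trace (a ** (matrix_power N k ** b ** a))"
    by (simp add: alpha_def N_def[symmetric] matrix_power_commute flip: matrix_mul_assoc)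
  also have "\<dots> = trace (matrix_power N k ** b ** (a ** a))"
    by (subst trace_mul_sym) (simp add: matrix_mul_assoc)
  also have "\<dots> = (c - 1) *\<^sub>R trace (matrix_power N k ** (b ** a)) +
      c *\<^sub>R trace (matrix_power N k ** (b ** p))"
    unfolding V.turn_square by (simp add: matrix_mult_distribs matrix_trace_simps flip: matrix_mul_assoc)
  finally show ?thesis
    by (simp add: tau_def beta_def N_def[symmetric] matrix_power_commute W.turn_absorbs)
qed

lemma beta_Suc: "beta (Suc k) = (d - 1) *\<^sub>R tau (Suc k) + d *\<^sub>R alpha k"
proof -
  have "beta (Suc k) = trace (b ** (b ** a ** matrix_power N k))"
    by (subst trace_mul_sym) (simp add: beta_def N_def matrix_mul_assoc)
  also have "\<dots> = (d - 1) *\<^sub>R trace ((b ** a) ** matrix_power N k) +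
      d *\<^sub>R trace ((p ** a) ** matrix_power N k)"
    by (simp add: matrix_mul_assoc W.turn_square) (simp add: matrix_mult_distribs matrix_trace_simps)
  finally show ?thesis
    by (simp add: tau_def alpha_def N_def[symmetric] V.turn_absorbs)
qed

text \<open>
  Because \<open>a ** X = c X\<close>, for a graph and positive \<open>k\<close> this is \<open>c\<close> times the matrix that sums
  the weights of the non-backtracking paths of length \<open>2 k\<close> between two vertices of the first class, tails
  included.
\<close>

definition Q where "Q k = Xs ** matrix_power N k ** X"

text \<open>
  The closed non-backtracking paths are those without a tail, counted by \<open>tau\<close>, and those with
  one, counted by \<open>beta\<close>.
\<close>

lemma trace_Q: "trace (Q (Suc k)) = c *\<^sub>R (tau (Suc k) + beta k)"
proof -
  have "trace (Q (Suc k)) = trace (X ** Xs ** matrix_power N (Suc k))"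
    unfolding Q_def by (subst trace_mul_sym) (simp add: matrix_mul_assoc)
  also have "\<dots> = alpha (Suc k) + tau (Suc k)"
    by (simp add: V.incidence_mult_star matrix_mult_distribs alpha_def tau_def matrix_trace_simps
        matrix_mul_assoc N_absorbs)
  finally show ?thesis by (simp add: alpha_Suc algebra_simps)
qed

lemma Q_recursion: "Q (Suc (Suc k)) = H ** Q (Suc k) - (c * d) *\<^sub>R Q k"
  unfolding Q_def star_N_recursion by (simp add: matrix_mult_distribs matrix_mul_assoc)

lemma Q_0: "Q 0 = (c + 1) *\<^sub>R mat 1"
  by (simp add: Q_def V.star_mult)

lemma Q_1: "Q (Suc 0) = c *\<^sub>R H + (c * (d - 1)) *\<^sub>R mat 1"
proof -
  have "Q (Suc 0) = H ** (Xs ** X) + (d - 1) *\<^sub>R (Xs ** X) - Xs ** b ** X"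
    unfolding Q_def by (simp add: star_N matrix_mult_distribs matrix_mul_assoc)
  also have "\<dots> = (c + 1) *\<^sub>R H + ((d - 1) * (c + 1)) *\<^sub>R mat 1 - (H + (d - 1) *\<^sub>R mat 1)"
    by (simp add: V.star_mult star_W_turn_incidence matrix_mult_distribs H_def algebra_simps)
  finally show ?thesis by (simp add: algebra_simps)
qed

text \<open>
  Below, \<open>D k\<close> stands for \<open>2 T\<^sub>k(M)\<close> with \<open>T\<^sub>k\<close> the rescaled Chebyshev polynomial. Only its
  recursion matters.
\<close>

context
  fixes D :: "nat \<Rightarrow> complex ^ 'v ^ 'v"
  assumes D_0: "D 0 = 2 *\<^sub>R mat 1" and D_1: "D (Suc 0) = H"
    and D_recursion: "\<And>k. D (Suc (Suc k)) = H ** D (Suc k) - (c * d) *\<^sub>R D k"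
begin

text \<open>
  Both sides satisfy the same three-term recursion, so it suffices to compare the first two values.
  The combination on the left is the one whose trace no longer involves \<open>alpha\<close> and \<open>beta\<close>, as
  the next proof shows.
\<close>

lemma Q_eq_D:
  "Q (Suc (Suc k)) - (c * d) *\<^sub>R Q k =
     c *\<^sub>R (D (Suc (Suc k)) + (d - 1) *\<^sub>R D (Suc k) - d *\<^sub>R D k)"
proof -
  define E where "E k = Q (Suc (Suc k)) - (c * d) *\<^sub>R Q k -
     c *\<^sub>R (D (Suc (Suc k)) + (d - 1) *\<^sub>R D (Suc k) - d *\<^sub>R D k)" for k
  \<comment> \<open>The difference is a combination with scalar coefficients of shifts of two solutions, hence a solution.\<close>
  have E_rec: "E (Suc (Suc k)) = H ** E (Suc k) - (c * d) *\<^sub>R E k" for k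
  proof -
    have "H ** Q (Suc m) = Q (Suc (Suc m)) + (c * d) *\<^sub>R Q m"
      "H ** D (Suc m) = D (Suc (Suc m)) + (c * d) *\<^sub>R D m" for m
      by (simp_all add: Q_recursion D_recursion)
    thus ?thesis
      by (simp add: E_def matrix_mult_distribs scaleR_right_distrib scaleR_right_diff_distrib
          mult.assoc mult.commute mult.left_commute)
  qed
  \<comment> \<open>Numerals act componentwise on matrices, so they agree with real scalars.\<close>
  have two: "B * 2 = (2::real) *\<^sub>R B" "2 * B = (2::real) *\<^sub>R B" for B :: "complex ^ 'v ^ 'v"
    by (simp_all add: vec_eq_iff scaleR_conv_of_real)
  have E_0: "E 0 = 0"
    unfolding E_def Q_recursion D_recursion Q_0 Q_1 D_0 D_1
    by (simp add: matrix_mult_distribs algebra_simps two)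
  have E_1: "E (Suc 0) = 0"
    unfolding E_def Q_recursion D_recursion Q_0 Q_1 D_0 D_1
    by (simp add: matrix_mult_distribs algebra_simps two)
  have "E k = 0 \<and> E (Suc k) = 0"
    by (induction k) (auto simp: E_0 E_1 E_rec matrix_mult_distribs)
  thus ?thesis by (simp add: E_def)
qed

text \<open>
  Applying the relations for \<open>alpha\<close> and \<open>beta\<close> twice gives \<open>beta (k + 2)\<close> in terms of
  \<open>tau\<close> and \<open>c d beta k\<close>; the latter is cancelled by \<open>- c d Q (k + 1)\<close>. What remains is the
  combination \<open>tau (k + 3) + (d - 1) tau (k + 2) - d tau (k + 1)\<close>, which by the previous lemma
  has the same value for \<open>trace (D k)\<close> in place of \<open>tau k\<close>.
\<close>

lemma tau_recursion:
  defines "g \<equiv> \<lambda>k. tau k - trace (D k)"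
  shows "g (Suc (Suc (Suc k))) = d *\<^sub>R g (Suc k) - (d - 1) *\<^sub>R g (Suc (Suc k))"
proof -
  let ?k = "Suc k"
  have "c *\<^sub>R (tau (Suc (Suc ?k)) + (d - 1) *\<^sub>R tau (Suc ?k) - d *\<^sub>R tau ?k) =
     trace (Q (Suc (Suc ?k)) - (c * d) *\<^sub>R Q ?k)"
    by (simp add: trace_Q beta_Suc alpha_Suc matrix_trace_simps algebra_simps)
  also have "\<dots> = c *\<^sub>R trace (D (Suc (Suc ?k)) + (d - 1) *\<^sub>R D (Suc ?k) - d *\<^sub>R D ?k)"
    by (subst Q_eq_D) (simp add: trace_scaleR)
  finally have "tau (Suc (Suc ?k)) + (d - 1) *\<^sub>R tau (Suc ?k) - d *\<^sub>R tau ?k =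
      trace (D (Suc (Suc ?k)) + (d - 1) *\<^sub>R D (Suc ?k) - d *\<^sub>R D ?k)"
    using c_nonzero by simp
  thus ?thesis
    by (simp add: g_def matrix_trace_simps algebra_simps)
qed

lemma tau_1: "tau (Suc 0) = trace (D (Suc 0)) + (d - 1) *\<^sub>R of_nat CARD('v)"
proof -
  have "tau (Suc 0) = 0" "beta 0 = 0"
    using traces by (simp_all add: tau_def beta_def N_def)
  with trace_Q[of 0] have "c *\<^sub>R (trace H + (d - 1) *\<^sub>R of_nat CARD('v)) = 0"
    by (simp add: Q_1 matrix_trace_simps trace_I algebra_simps)
  thus ?thesis
    using \<open>tau (Suc 0) = 0\<close> c_nonzero by (simp add: D_1)
qed

lemma tau_2: "tau (Suc (Suc 0)) = trace (D (Suc (Suc 0))) + (c * d + d - d\<^sup>2 - 1) *\<^sub>R of_nat CARD('v)"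
proof -
  have "tau (Suc 0) = 0" "beta (Suc 0) = 0"
    using traces by (simp_all add: tau_def beta_Suc alpha_def N_def)
  hence "c *\<^sub>R tau (Suc (Suc 0)) = trace (Q (Suc (Suc 0)) - (c * d) *\<^sub>R Q 0) + (c * d) *\<^sub>R trace (Q 0)"
    by (simp add: trace_Q matrix_trace_simps)
  also have "\<dots> = c *\<^sub>R (trace (D (Suc (Suc 0))) + (d - 1) *\<^sub>R trace (D (Suc 0)) -
      d *\<^sub>R trace (D 0) + (d * (c + 1)) *\<^sub>R of_nat CARD('v))"
    by (subst Q_eq_D) (simp add: matrix_trace_simps trace_I Q_0 algebra_simps)
  also have "trace (D (Suc 0)) = - ((d - 1) *\<^sub>R of_nat CARD('v))"
    using tau_1 \<open>tau (Suc 0) = 0\<close> by (simp add: eq_neg_iff_add_eq_0)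
  finally have "tau (Suc (Suc 0)) = trace (D (Suc (Suc 0))) + (d - 1) *\<^sub>R - ((d - 1) *\<^sub>R of_nat CARD('v)) -
      d *\<^sub>R trace (D 0) + (d * (c + 1)) *\<^sub>R of_nat CARD('v)"
    using c_nonzero by simp
  moreover have "trace (D 0) = 2 * of_nat CARD('v)"
    by (simp only: D_0 trace_scaleR trace_I) (simp add: scaleR_conv_of_real)
  ultimately show ?thesis
    by (simp add: scaleR_conv_of_real algebra_simps power2_eq_square)
qed

text \<open>
  The recursion for \<open>tau - trace D\<close> has the characteristic roots \<open>1\<close> and \<open>- d\<close>. The additive
  constant is the solution with the initial values found at \<open>1\<close> and \<open>2\<close>. The recursion does not
  extend down to index \<open>0\<close>, where \<open>N\<close> to the power \<open>0\<close> is not the projection \<open>p\<close>.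
\<close>

theorem trace_N_power:
  assumes "d \<noteq> -1"
  shows "tau (Suc k) = trace (D (Suc k)) +
     (((c - d) * (- d) ^ Suc k + c * d - 1) / (d + 1)) *\<^sub>R of_nat CARD('v)"
proof -
  define s where "s k = ((c - d) * (- d) ^ k + c * d - 1) / (d + 1)" for k
  have d: "d + 1 \<noteq> 0" using assms by linarith
  have s: "s (Suc 0) = d - 1" "s (Suc (Suc 0)) = c * d + d - d\<^sup>2 - 1"
    "s (Suc (Suc k)) = d * s k - (d - 1) * s (Suc k)" for k
  proof -
    have s': "(d + 1) * s k = (c - d) * (- d) ^ k + c * d - 1" for k
      using d by (simp add: s_def)
    show "s (Suc 0) = d - 1" "s (Suc (Suc 0)) = c * d + d - d\<^sup>2 - 1"
      by (rule mult_left_cancel[OF d, THEN iffD1], subst s', simp add: algebra_simps power2_eq_square)+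
    have "(d + 1) * s (Suc (Suc k)) = d * ((d + 1) * s k) - (d - 1) * ((d + 1) * s (Suc k))"
      unfolding s' by (simp add: algebra_simps)
    hence "(d + 1) * s (Suc (Suc k)) = (d + 1) * (d * s k - (d - 1) * s (Suc k))"
      by (simp add: algebra_simps)
    thus "s (Suc (Suc k)) = d * s k - (d - 1) * s (Suc k)"
      using d by simp
  qed
  have "tau (Suc k) - trace (D (Suc k)) = s (Suc k) *\<^sub>R of_nat CARD('v) \<and>
      tau (Suc (Suc k)) - trace (D (Suc (Suc k))) = s (Suc (Suc k)) *\<^sub>R of_nat CARD('v)"
  proof (induction k)
    case 0
    show ?case using tau_1 tau_2 s by simp
  next
    case (Suc k)
    thus ?case 
      unfolding s(3)[of "Suc k"] tau_recursion by (simp add: algebra_simps)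
  qed
  thus ?thesis by (simp add: s_def algebra_simps)
qed

end

end

section \<open>Rescaled Chebyshev polynomials of a matrix\<close>

lemma chebyshev_T_0: "chebyshev_T 0 = 1"
  by (rule chebyshev_poly_unique) (simp add: poly_chebyshev_T_cos)

lemma chebyshev_T_1: "chebyshev_T (Suc 0) = [:0, 1:]"
  by (rule chebyshev_poly_unique) (simp add: poly_chebyshev_T_cos)

lemma chebyshev_T_recursion:
  "chebyshev_T (Suc (Suc k)) = [:0, 2:] * chebyshev_T (Suc k) - chebyshev_T k"
proof (rule chebyshev_poly_unique)
  fix \<theta> :: real
  have "cos (real (Suc k) * \<theta> + \<theta>) + cos (real (Suc k) * \<theta> - \<theta>) =
      2 * cos \<theta> * cos (real (Suc k) * \<theta>)"
    unfolding cos_add cos_diff by simp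
  thus "poly (chebyshev_T (Suc (Suc k))) (cos \<theta>) =
      poly ([:0, 2:] * chebyshev_T (Suc k) - chebyshev_T k) (cos \<theta>)"
    by (simp add: poly_chebyshev_T_cos algebra_simps)
qed

text \<open>
  The factor \<open>(c d)\<^sup>k\<^sup>/\<^sup>2\<close> and the affine substitution turn \<open>T\<^sub>k\<^sub>+\<^sub>2 = 2 x T\<^sub>k\<^sub>+\<^sub>1 - T\<^sub>k\<close> into a recursion
  that is free of square roots.
\<close>

lemma chebyshev_T_tilde_recursion:
  assumes "c * d > 0"
  shows "chebyshev_T_tilde c d 0 = 1"
    and "chebyshev_T_tilde c d (Suc 0) = smult (1 / 2) [:- real (c + d), 1:]"
    and "chebyshev_T_tilde c d (Suc (Suc k)) =
      [:- real (c + d), 1:] * chebyshev_T_tilde c d (Suc k) -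
      smult (real (c * d)) (chebyshev_T_tilde c d k)"
proof -
  \<comment> \<open>Twice this root is the scale of the substitution, and its powers are the leading factors.\<close>
  define s where "s = sqrt (real (c * d))"
  have s: "s > 0" "s * s = real (c * d)"
    using assms by (simp_all add: s_def)
  define q where "q = [:- real (c + d) / (2 * s), 1 / (2 * s):]"
  have powr: "real (c * d) powr (real k / 2) = s ^ k" for k
  proof -
    have "real (c * d) powr (real k / 2) = (real (c * d) powr (1 / 2)) powr real k"
      by (simp add: powr_powr)
    also have "\<dots> = s ^ k"
      using s(1) assms by (simp add: s_def powr_half_sqrt powr_realpow del: of_nat_mult)
    finally show ?thesis .
  qed
  have tilde: "chebyshev_T_tilde c d k = smult (s ^ k) (chebyshev_T k \<circ>\<^sub>p q)" for k
    unfolding chebyshev_T_tilde_def powr q_def s_def by simp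
  have q: "smult (2 * s) q = [:- real (c + d), 1:]"
    using s(1) by (simp add: q_def)
  show "chebyshev_T_tilde c d 0 = 1"
    by (simp add: tilde chebyshev_T_0 pcompose_1)
  show "chebyshev_T_tilde c d (Suc 0) = smult (1 / 2) [:- real (c + d), 1:]"
    unfolding q[symmetric] by (simp add: tilde chebyshev_T_1 pcompose_pCons)
  have "chebyshev_T_tilde c d (Suc (Suc k)) =
      smult (2 * s) q * smult (s ^ Suc k) (chebyshev_T (Suc k) \<circ>\<^sub>p q) -
      smult (s * s) (smult (s ^ k) (chebyshev_T k \<circ>\<^sub>p q))"
    by (simp add: tilde chebyshev_T_recursion pcompose_diff pcompose_mult pcompose_pCons pcompose_smult
        smult_diff_right mult_ac)
  thus "chebyshev_T_tilde c d (Suc (Suc k)) =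
      [:- real (c + d), 1:] * chebyshev_T_tilde c d (Suc k) -
      smult (real (c * d)) (chebyshev_T_tilde c d k)"
    unfolding q s(2) tilde .
qed

text \<open>
  The sum that defines a polynomial of a matrix may be extended beyond the degree, which makes the
  definition additive in spite of cancellation of leading terms.
\<close>

lemma poly_matrix_degree_le:
  assumes "degree q \<le> n"
  shows "poly_matrix q M = (\<Sum>i\<le>n. coeff q i *\<^sub>R matrix_power M i)"
  unfolding poly_matrix_def using assms
  by (intro sum.mono_neutral_left) (auto simp: coeff_eq_0)

lemma poly_matrix_diff: "poly_matrix (q - r) M = poly_matrix q M - poly_matrix r M"
  using poly_matrix_degree_le[of "q - r" "max (degree q) (degree r)" M]
    poly_matrix_degree_le[of q "max (degree q) (degree r)" M]
    poly_matrix_degree_le[of r "max (degree q) (degree r)" M]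
  by (simp add: degree_diff_le_max sum_subtractf scaleR_left_diff_distrib)

lemma poly_matrix_smult: "poly_matrix (smult u q) M = u *\<^sub>R poly_matrix q M"
  using poly_matrix_degree_le[of "smult u q" "degree q" M]
  by (simp add: degree_smult_le poly_matrix_def scaleR_sum_right)

lemma poly_matrix_pCons: "poly_matrix (pCons u q) M = u *\<^sub>R mat 1 + M ** poly_matrix q M"
  using poly_matrix_degree_le[of "pCons u q" "Suc (degree q)" M]
  by (simp add: degree_pCons_le sum.atMost_Suc_shift poly_matrix_def matrix_mult_sum_right
      matrix_mult_distribs del: sum.atMost_Suc)

lemma poly_matrix_shift_mult:
  "poly_matrix ([:- u, 1:] * q) M = (M - u *\<^sub>R mat 1) ** poly_matrix q M"
proof -
  have "[:- u, 1:] * q = pCons 0 q - smult u q" by simp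
  thus ?thesis
    by (simp only: poly_matrix_diff poly_matrix_pCons poly_matrix_smult)
      (simp add: matrix_mult_distribs)
qed

lemma poly_matrix_1: "poly_matrix 1 M = mat 1"
  by (simp add: poly_matrix_def)

lemma poly_matrix_chebyshev_T_tilde_recursion:
  fixes M :: "complex ^ 'n ^ 'n"
  assumes "c * d > 0"
  defines "H \<equiv> M - real (c + d) *\<^sub>R mat 1"
    and "D \<equiv> \<lambda>k. 2 *\<^sub>R poly_matrix (chebyshev_T_tilde c d k) M"
  shows "D 0 = 2 *\<^sub>R mat 1" "D (Suc 0) = H"
    and "D (Suc (Suc k)) = H ** D (Suc k) - (real c * real d) *\<^sub>R D k"
proof -
  note T = chebyshev_T_tilde_recursion[OF assms(1)]
  show "D 0 = 2 *\<^sub>R mat 1"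
    by (simp only: D_def T poly_matrix_1)
  have "poly_matrix [:- real (c + d), 1:] M = H"
    using poly_matrix_shift_mult[of "real (c + d)" 1 M]
    by (simp add: poly_matrix_1 H_def)
  thus "D (Suc 0) = H"
    by (simp only: D_def T poly_matrix_smult) simp
  show "D (Suc (Suc k)) = H ** D (Suc k) - (real c * real d) *\<^sub>R D k"
    unfolding D_def H_def T(3) poly_matrix_diff poly_matrix_shift_mult poly_matrix_smult
      matrix_mult_distribs
    by (simp only: scaleR_diff_right scaleR_scaleR of_nat_mult mult.commute)
qed

section \<open>Walks and powers of matrices\<close>

text \<open>
  A walk with \<open>k\<close> steps in an arbitrary index type, as the list of its \<open>k + 1\<close> positions.
\<close>

definition walks :: "nat \<Rightarrow> 'e \<Rightarrow> 'e \<Rightarrow> 'e list set" where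
  "walks k x y = {es. length es = Suc k \<and> es ! 0 = x \<and> es ! k = y}"

lemma finite_walks: "finite (walks k x (y :: 'e :: finite))"
  by (rule finite_subset[OF _ finite_lists_length_eq[of UNIV "Suc k"]]) (auto simp: walks_def)

lemma walks_Suc: "walks (Suc k) x y = (\<Union>z. (#) x ` walks k z y)"
  by (auto simp: walks_def length_Suc_conv image_iff)

lemma matrix_power_entry:
  fixes M :: "'a::comm_semiring_1 ^ 'e::finite ^ 'e"
  shows "matrix_power M k $ x $ y = (\<Sum>es \<in> walks k x y. \<Prod>i<k. M $ (es ! i) $ (es ! Suc i))"
proof (induction k arbitrary: x)
  case 0
  have "walks 0 x y = (if x = y then {[x]} else {})"
    by (auto simp: walks_def length_Suc_conv)
  thus ?case by (simp add: mat_def)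
next
  case (Suc k)
  have "(\<Sum>es \<in> walks (Suc k) x y. \<Prod>i<Suc k. M $ (es ! i) $ (es ! Suc i)) =
      (\<Sum>z\<in>UNIV. \<Sum>es \<in> (#) x ` walks k z y. \<Prod>i<Suc k. M $ (es ! i) $ (es ! Suc i))"
    unfolding walks_Suc by (intro sum.UNION_disjoint) (auto simp: finite_walks, auto simp: walks_def)
  also have "\<dots> = (\<Sum>z\<in>UNIV. \<Sum>es \<in> walks k z y. M $ x $ z * (\<Prod>i<k. M $ (es ! i) $ (es ! Suc i)))"
    by (rule sum.cong[OF refl], subst sum.reindex)
      (auto simp: prod.lessThan_Suc_shift walks_def intro!: sum.cong simp del: prod.lessThan_Suc)
  finally show ?case
    by (simp add: matrix_matrix_mult_def Suc.IH sum_distrib_left)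
qed

lemma trace_matrix_power:
  fixes M :: "'a::comm_semiring_1 ^ 'e::finite ^ 'e"
  shows "trace (matrix_power M k) =
    (\<Sum>es | length es = Suc k \<and> es ! k = es ! 0. \<Prod>i<k. M $ (es ! i) $ (es ! Suc i))"
proof -
  have "{es. length es = Suc k \<and> es ! k = es ! 0} = (\<Union>x::'e. walks k x x)"
    by (auto simp: walks_def)
  thus ?thesis
    unfolding trace_def matrix_power_entry
    by (simp only:, intro sum.UNION_disjoint[symmetric]) (auto simp: finite_walks, auto simp: walks_def)
qed

section \<open>Closed non-backtracking paths as closed walks on edges\<close>

text \<open>
  A path \<open>(v\<^sub>0, w\<^sub>1, v\<^sub>1, \<dots>, w\<^sub>k, v\<^sub>k)\<close> is cut into the edges \<open>(v\<^sub>0, w\<^sub>1), \<dots>, (v\<^sub>k\<^sub>-\<^sub>1, w\<^sub>k)\<close>. For a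
  closed path the edge list is closed up by repeating its first entry at position \<open>k\<close>, so that
  the tail condition becomes one more step condition.
\<close>

definition vertices_of_edges :: "nat \<Rightarrow> ('v \<times> 'w) list \<Rightarrow> ('v + 'w) list" where
  "vertices_of_edges k es = map (\<lambda>j. if even j then Inl (fst (es ! (j div 2)))
     else Inr (snd (es ! (j div 2)))) [0..<Suc (2 * k)]"

text \<open>
  At position \<open>k\<close> the vertex list has ended, so the second component restarts with the first
  vertex in \<open>W\<close>, which is at position \<open>1\<close>.
\<close>

definition edges_of_vertices :: "nat \<Rightarrow> ('v + 'w) list \<Rightarrow> ('v \<times> 'w) list" where
  "edges_of_vertices k p =
     map (\<lambda>i. (projl (p ! (2 * i)), projr (p ! (if i < k then Suc (2 * i) else 1)))) [0..<Suc k]"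

lemma nth_vertices_of_edges:
  "length (vertices_of_edges k es) = Suc (2 * k)"
  "i \<le> k \<Longrightarrow> vertices_of_edges k es ! (2 * i) = Inl (fst (es ! i))"
  "i < k \<Longrightarrow> vertices_of_edges k es ! Suc (2 * i) = Inr (snd (es ! i))"
  by (simp_all add: vertices_of_edges_def nth_map_upt del: upt_Suc)

lemma nth_edges_of_vertices:
  "length (edges_of_vertices k p) = Suc k"
  "i < k \<Longrightarrow> edges_of_vertices k p ! i = (projl (p ! (2 * i)), projr (p ! Suc (2 * i)))"
  "edges_of_vertices k p ! k = (projl (p ! (2 * k)), projr (p ! 1))"
  by (simp_all add: edges_of_vertices_def nth_map_upt del: upt_Suc)

lemma edges_of_vertices_of_edges:
  assumes "length es = Suc k" "es ! k = es ! 0" "k \<ge> 1"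
  shows "edges_of_vertices k (vertices_of_edges k es) = es"
proof (rule nth_equalityI)
  fix i assume "i < length (edges_of_vertices k (vertices_of_edges k es))"
  hence "i < k \<or> i = k" by (auto simp: nth_edges_of_vertices)
  thus "edges_of_vertices k (vertices_of_edges k es) ! i = es ! i"
    using assms nth_vertices_of_edges(3)[of 0 k es]
    by (auto simp: nth_edges_of_vertices nth_vertices_of_edges)
qed (simp add: assms nth_edges_of_vertices)

lemma set_vwalk_arcs: "set (vwalk_arcs p) = {(p ! j, p ! Suc j) | j. Suc j < length p}"
proof (induction p rule: vwalk_arcs.induct)
  case (3 x y xs)
  have "{(((x # y # xs) ! j), (x # y # xs) ! Suc j) | j. Suc j < length (x # y # xs)} =
      insert (x, y) {((y # xs) ! j, (y # xs) ! Suc j) | j. Suc j < length (y # xs)}"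
    (is "?L = ?R")
  proof
    show "?L \<subseteq> ?R"
    proof
      fix e assume "e \<in> ?L"
      then obtain j where "e = ((x # y # xs) ! j, (x # y # xs) ! Suc j)" "Suc j < length (x # y # xs)"
        by blast
      thus "e \<in> ?R" by (cases j) auto
    qed
    show "?R \<subseteq> ?L" by force
  qed
  thus ?case using 3 by simp
qed auto

lemma all_less_double: "(\<forall>j<2 * k. P j) \<longleftrightarrow> (\<forall>i<k. P (2 * i) \<and> P (Suc (2 * i)))" for k :: nat
proof safe
  fix j assume *: "\<forall>i<k. P (2 * i) \<and> P (Suc (2 * i))" "j < 2 * k"
  show "P j"
    using * by (cases "even j") (auto elim!: evenE oddE)
qed auto

lemma matrix_mult_entry: "(A ** B) $ i $ j = (\<Sum>k\<in>UNIV. A $ i $ k * B $ k $ j)"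
  by (simp add: matrix_matrix_mult_def)

lemma scaled_mat_1_entry:
  "(r *\<^sub>R (mat 1 :: complex ^ 'n ^ 'n)) $ i $ j = (if i = j then of_real r else 0)"
  by (simp only: vector_scaleR_component mat_def vec_lambda_beta) (simp add: scaleR_conv_of_real)

locale generalized_adjacency =
  fixes G :: "('v::finite + 'w::finite) pair_pre_digraph" and A :: "complex ^ 'w ^ 'v"
  assumes bipartite: "bipartite_graph G" and adjacency: "gen_adjacency_matrix G A"
begin

lemma arc_iff:
  "(Inl v, Inr w) \<in> parcs G \<longleftrightarrow> A $ v $ w \<noteq> 0"
  "(Inr w, Inl v) \<in> parcs G \<longleftrightarrow> A $ v $ w \<noteq> 0"
  "(Inl v, Inl v') \<notin> parcs G" "(Inr w, Inr w') \<notin> parcs G"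
proof -
  interpret pair_graph G using bipartite by (simp add: bipartite_graph_def)
  have sym: "(x, y) \<in> parcs G \<longleftrightarrow> (y, x) \<in> parcs G" for x y
    using arcs_symmetric by blast
  show *: "(Inl v, Inr w) \<in> parcs G \<longleftrightarrow> A $ v $ w \<noteq> 0"
    using adjacency unfolding gen_adjacency_matrix_def with_proj_simps
    by (metis norm_zero zero_neq_one)
  show "(Inr w, Inl v) \<in> parcs G \<longleftrightarrow> A $ v $ w \<noteq> 0"
    using * sym by blast
  show "(Inl v, Inl v') \<notin> parcs G" "(Inr w, Inr w') \<notin> parcs G"
    using bipartite unfolding bipartite_graph_def with_proj_simps by blast+
qed

lemma vwalk_iff: "vwalk p G \<longleftrightarrow> p \<noteq> [] \<and> (\<forall>j. Suc j < length p \<longrightarrow> (p ! j, p ! Suc j) \<in> parcs G)"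
  using bipartite unfolding vwalk_def set_vwalk_arcs bipartite_graph_def by auto

text \<open>
  The path goes from \<open>v\<close> along the edge \<open>e = (v, w)\<close>, on to \<open>v'\<close>, and will leave \<open>v'\<close> along the
  edge \<open>f = (v', w')\<close>. The two inequalities are the non-backtracking conditions at \<open>w\<close> and \<open>v'\<close>.
\<close>

definition step :: "'v \<times> 'w \<Rightarrow> 'v \<times> 'w \<Rightarrow> bool" where
  "step e f \<longleftrightarrow> fst e \<noteq> fst f \<and> snd e \<noteq> snd f \<and>
     A $ fst e $ snd e \<noteq> 0 \<and> A $ fst f $ snd e \<noteq> 0 \<and> A $ fst f $ snd f \<noteq> 0"

definition cyclic_walks :: "nat \<Rightarrow> ('v \<times> 'w) list set" where
  "cyclic_walks k = {es. length es = Suc k \<and> es ! k = es ! 0 \<and> (\<forall>i<k. step (es ! i) (es ! Suc i))}"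

text \<open>
  The step condition at \<open>i\<close> covers the non-backtracking condition at the positions \<open>2 i + 1\<close> and
  \<open>2 i + 2\<close> of the path. For the last step the second of these wraps around and is the condition
  of being tailless.
\<close>

lemma vertices_of_edges_mem_iff:
  assumes "length es = Suc k" "es ! k = es ! 0" "k \<ge> 1"
  shows "vertices_of_edges k es \<in> closed_nbt_paths_from_V G (2 * k) \<longleftrightarrow> es \<in> cyclic_walks k"
proof -
  define p where "p = vertices_of_edges k es"
  note len = nth_vertices_of_edges(1)[of k es, folded p_def]
  note pV = nth_vertices_of_edges(2)[of _ k es, folded p_def]
  note pW = nth_vertices_of_edges(3)[of _ k es, folded p_def]
  have pV': "p ! Suc (Suc (2 * i)) = Inl (fst (es ! Suc i))" if "i < k" for i
    using pV[of "Suc i"] that by simp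
  have pW': "p ! Suc (Suc (Suc (2 * i))) = Inr (snd (es ! Suc i))" if "Suc i < k" for i
    using pW[of "Suc i"] that by simp
  have p0: "p ! 0 = Inl (fst (es ! 0))" and p1: "p ! Suc 0 = Inr (snd (es ! 0))"
    using pV[of 0] pW[of 0] assms by simp_all
  obtain m where m: "k = Suc m" using assms(3) by (cases k) auto
  have "p \<noteq> []" using len by auto
  hence path: "path_of_length G (2 * k) p \<longleftrightarrow>
      (\<forall>i<k. A $ fst (es ! i) $ snd (es ! i) \<noteq> 0 \<and> A $ fst (es ! Suc i) $ snd (es ! i) \<noteq> 0)"
  proof -
    have "path_of_length G (2 * k) p \<longleftrightarrow> (\<forall>j<2 * k. (p ! j, p ! Suc j) \<in> parcs G)"
      unfolding path_of_length_def vwalk_iff using \<open>p \<noteq> []\<close> by (auto simp: len)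
    thus ?thesis
      unfolding all_less_double by (simp add: pV pW pV' arc_iff)
  qed
  have closed: "closed_path p"
    using assms pV[of k] by (simp add: closed_path_def len p0)
  have "non_backtracking p \<longleftrightarrow> (\<forall>j. Suc j < 2 * k \<longrightarrow> p ! Suc (Suc j) \<noteq> p ! j)"
    unfolding non_backtracking_def vwalk_length_simp len
  proof safe
    fix j assume "\<forall>j. 1 \<le> j \<and> j + 1 \<le> Suc (2 * k) - 1 \<longrightarrow> p ! (j + 1) \<noteq> p ! (j - 1)"
      "Suc j < 2 * k" "p ! Suc (Suc j) = p ! j"
    thus False by (auto dest!: spec[of _ "Suc j"])
  next
    fix j assume *: "\<forall>j. Suc j < 2 * k \<longrightarrow> p ! Suc (Suc j) \<noteq> p ! j"
      "1 \<le> j" "j + 1 \<le> Suc (2 * k) - 1" "p ! (j + 1) = p ! (j - 1)"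
    thus False using spec[OF *(1), of "j - 1"] by simp
  qed
  also have "\<dots> \<longleftrightarrow> (\<forall>j<2 * k. Suc j < 2 * k \<longrightarrow> p ! Suc (Suc j) \<noteq> p ! j)" by auto
  also have "\<dots> \<longleftrightarrow> (\<forall>i<k. fst (es ! i) \<noteq> fst (es ! Suc i)) \<and>
      (\<forall>i<m. snd (es ! i) \<noteq> snd (es ! Suc i))"
    unfolding all_less_double using m
    by (auto simp: pV pW pV' pW') (metis less_SucI)
  finally have nb: "non_backtracking p \<longleftrightarrow> (\<forall>i<k. fst (es ! i) \<noteq> fst (es ! Suc i)) \<and>
      (\<forall>i<m. snd (es ! i) \<noteq> snd (es ! Suc i))" .
  have tail: "tailless p \<longleftrightarrow> snd (es ! m) \<noteq> snd (es ! Suc m)"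
    using assms pW[of m] by (simp add: tailless_def len p1 m)
  have W: "(\<forall>i<m. snd (es ! i) \<noteq> snd (es ! Suc i)) \<and> snd (es ! m) \<noteq> snd (es ! Suc m) \<longleftrightarrow>
      (\<forall>i<k. snd (es ! i) \<noteq> snd (es ! Suc i))"
    unfolding m by (auto simp: less_Suc_eq)
  \<comment> \<open>Each step requires its target to be an edge; for the last step that is the edge at position 0.\<close>
  have final_edge: "A $ fst (es ! Suc i) $ snd (es ! Suc i) \<noteq> 0"
    if "\<forall>i<k. A $ fst (es ! i) $ snd (es ! i) \<noteq> 0" "i < k" for i
    using that assms by (cases "Suc i = k") auto
  show ?thesis
    unfolding p_def[symmetric] closed_nbt_paths_from_V_def cyclic_walks_def mem_Collect_eq
      path nb tail step_def
    using assms closed p0 W final_edge by auto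
qed

text \<open>
  A path that starts in \<open>V\<close> alternates between the classes, hence it is determined by its edges.
\<close>

lemma vertices_of_edges_of_vertices:
  assumes "p \<in> closed_nbt_paths_from_V G (2 * k)" "k \<ge> 1"
  shows "vertices_of_edges k (edges_of_vertices k p) = p"
    and "edges_of_vertices k p ! k = edges_of_vertices k p ! 0"
proof -
  have len: "length p = Suc (2 * k)" and p0: "p ! 0 \<in> range Inl" and closed: "p ! (2 * k) = p ! 0"
    and arcs: "\<And>j. j < 2 * k \<Longrightarrow> (p ! j, p ! Suc j) \<in> parcs G"
    using assms unfolding closed_nbt_paths_from_V_def path_of_length_def vwalk_iff closed_path_def
    by (auto simp: Suc_diff_le)
  have "if even j then p ! j \<in> range Inl else p ! j \<in> range Inr" if "j \<le> 2 * k" for j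
    using that
  proof (induction j)
    case 0
    show ?case using p0 by simp
  next
    case (Suc j)
    thus ?case using arcs[of j] arc_iff(3,4)
      by (cases "p ! Suc j") (auto split: if_splits)
  qed
  note sides = this
  have V: "p ! (2 * i) = Inl (projl (p ! (2 * i)))" if "i \<le> k" for i
    using sides[of "2 * i"] that by auto
  have W: "p ! Suc (2 * i) = Inr (projr (p ! Suc (2 * i)))" if "i < k" for i
    using sides[of "Suc (2 * i)"] that by auto
  show closed': "edges_of_vertices k p ! k = edges_of_vertices k p ! 0"
    using assms(2) closed by (simp add: nth_edges_of_vertices)
  show "vertices_of_edges k (edges_of_vertices k p) = p"
  proof (rule nth_equalityI)
    fix j assume "j < length (vertices_of_edges k (edges_of_vertices k p))"
    hence "j < Suc (2 * k)" by (simp add: nth_vertices_of_edges)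
    then consider i where "j = 2 * i" "i < k" | i where "j = Suc (2 * i)" "i < k" | "j = 2 * k"
      by (cases "even j") (auto elim!: evenE oddE, fastforce+)
    thus "vertices_of_edges k (edges_of_vertices k p) ! j = p ! j"
      using V W by cases (simp_all add: nth_vertices_of_edges nth_edges_of_vertices)
  qed (simp add: nth_vertices_of_edges len)
qed

lemma A2_vertices_of_edges:
  "A2 A (vertices_of_edges k es) =
     (\<Prod>i<k. A $ fst (es ! i) $ snd (es ! i) * cnj (A $ fst (es ! Suc i) $ snd (es ! i)))"
proof -
  let ?p = "vertices_of_edges k es"
  have "A2 A ?p = (\<Prod>i<k. A $ projl (?p ! (2 * i)) $ projr (?p ! Suc (2 * i)) *
      cnj (A $ projl (?p ! (2 * Suc i)) $ projr (?p ! Suc (2 * i))))"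
    unfolding A2_def nth_vertices_of_edges vwalk_length_simp
    by (simp add: prod.atLeast1_atMost_eq)
  also have "\<dots> = (\<Prod>i<k. A $ fst (es ! i) $ snd (es ! i) * cnj (A $ fst (es ! Suc i) $ snd (es ! i)))"
    by (intro prod.cong refl) (simp add: nth_vertices_of_edges del: mult_Suc_right)
  finally show ?thesis .
qed

text \<open>
  Expanding the trace of a matrix power gives a sum over all closed lists of pairs. The
  entries vanish except at the lists that are cut from a closed non-backtracking tailless path,
  and there the product of entries is the weight of the path.
\<close>

lemma sum_closed_paths_eq_trace:
  fixes N :: "complex ^ ('v \<times> 'w) ^ ('v \<times> 'w)"
  assumes N: "\<And>e f. N $ e $ f =
      (if step e f then A $ fst e $ snd e * cnj (A $ fst f $ snd e) else 0)"
    and "k \<ge> 1"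
  shows "(\<Sum>\<gamma> \<in> closed_nbt_paths_from_V G (2 * k). A2 A \<gamma>) = trace (matrix_power N k)"
proof -
  have "(\<Sum>\<gamma> \<in> closed_nbt_paths_from_V G (2 * k). A2 A \<gamma>) =
      (\<Sum>es \<in> cyclic_walks k. \<Prod>i<k. N $ (es ! i) $ (es ! Suc i))"
  proof (rule sum.reindex_bij_witness[of _ "vertices_of_edges k" "edges_of_vertices k"])
    fix \<gamma> assume \<gamma>: "\<gamma> \<in> closed_nbt_paths_from_V G (2 * k)"
    note * = vertices_of_edges_of_vertices[OF \<gamma> \<open>k \<ge> 1\<close>]
    show "vertices_of_edges k (edges_of_vertices k \<gamma>) = \<gamma>" by (rule *)
    show mem: "edges_of_vertices k \<gamma> \<in> cyclic_walks k"
      using vertices_of_edges_mem_iff[OF _ *(2) \<open>k \<ge> 1\<close>] \<gamma> *(1)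
      by (simp add: nth_edges_of_vertices)
    show "(\<Prod>i<k. N $ (edges_of_vertices k \<gamma> ! i) $ (edges_of_vertices k \<gamma> ! Suc i)) = A2 A \<gamma>"
      using A2_vertices_of_edges[of k "edges_of_vertices k \<gamma>"] mem
      unfolding *(1) by (simp add: N cyclic_walks_def)
  next
    fix es assume es: "es \<in> cyclic_walks k"
    hence *: "length es = Suc k" "es ! k = es ! 0" by (simp_all add: cyclic_walks_def)
    show "edges_of_vertices k (vertices_of_edges k es) = es"
      by (rule edges_of_vertices_of_edges[OF * \<open>k \<ge> 1\<close>])
    show "vertices_of_edges k es \<in> closed_nbt_paths_from_V G (2 * k)"
      using vertices_of_edges_mem_iff[OF * \<open>k \<ge> 1\<close>] es by simp
  qed
  also have "\<dots> = (\<Sum>es | length es = Suc k \<and> es ! k = es ! 0. \<Prod>i<k. N $ (es ! i) $ (es ! Suc i))"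
  proof (rule sum.mono_neutral_left)
    show "finite {es :: ('v \<times> 'w) list. length es = Suc k \<and> es ! k = es ! 0}"
      by (rule finite_subset[OF _ finite_lists_length_eq[of UNIV "Suc k"]]) auto
  qed (auto simp: cyclic_walks_def N)
  finally show ?thesis unfolding trace_matrix_power .
qed

section \<open>Incidence matrices of a biregular graph\<close>

text \<open>
  The entries of \<open>A\<close> are distributed over the two incidence matrices so that their product is \<open>A\<close>:
  all weights are put on the side of \<open>W\<close>. There they do not disturb regularity, since they have
  absolute value \<open>1\<close>.
\<close>

definition edge_proj :: "complex ^ ('v \<times> 'w) ^ ('v \<times> 'w)" where
  "edge_proj = (\<chi> e f. of_bool (e = f \<and> A $ fst e $ snd e \<noteq> 0))"

definition V_incidence :: "complex ^ 'v ^ ('v \<times> 'w)" where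
  "V_incidence = (\<chi> e v. of_bool (v = fst e \<and> A $ fst e $ snd e \<noteq> 0))"

definition W_incidence :: "complex ^ 'w ^ ('v \<times> 'w)" where
  "W_incidence = (\<chi> e w. of_bool (w = snd e) * A $ fst e $ snd e)"

lemma edge_proj_entry: "edge_proj $ e $ f = of_bool (e = f \<and> A $ fst e $ snd e \<noteq> 0)"
  by (simp add: edge_proj_def)

lemma edge_proj_mult:
  "(edge_proj ** B) $ e $ x = (if A $ fst e $ snd e \<noteq> 0 then B $ e $ x else 0)"
  "(B' ** edge_proj) $ y $ e = (if A $ fst e $ snd e \<noteq> 0 then B' $ y $ e else 0)"
proof -
  have "(edge_proj ** B) $ e $ x = (\<Sum>f\<in>UNIV. if f = e
      then of_bool (A $ fst e $ snd e \<noteq> 0) * B $ e $ x else 0)"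
    unfolding matrix_mult_entry edge_proj_def by (intro sum.cong) auto
  thus "(edge_proj ** B) $ e $ x = (if A $ fst e $ snd e \<noteq> 0 then B $ e $ x else 0)" by simp
  have "(B' ** edge_proj) $ y $ e = (\<Sum>f\<in>UNIV. if f = e
      then of_bool (A $ fst e $ snd e \<noteq> 0) * B' $ y $ e else 0)"
    unfolding matrix_mult_entry edge_proj_def by (intro sum.cong) auto
  thus "(B' ** edge_proj) $ y $ e = (if A $ fst e $ snd e \<noteq> 0 then B' $ y $ e else 0)" by simp
qed

lemma unit_entries: "A $ v $ w * cnj (A $ v $ w) = of_bool (A $ v $ w \<noteq> 0)"
proof -
  have "A $ v $ w \<noteq> 0 \<Longrightarrow> norm (A $ v $ w) = 1"
    using adjacency unfolding gen_adjacency_matrix_def by (metis)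
  thus ?thesis
    by (cases "A $ v $ w = 0") (simp_all flip: complex_norm_square)
qed

lemma conj_transpose_V_mult_W: "conj_transpose V_incidence ** W_incidence = A"
proof -
  have "(\<Sum>e\<in>UNIV. cnj (of_bool (v = fst e \<and> A $ fst e $ snd e \<noteq> 0)) *
      (of_bool (w = snd e) * A $ fst e $ snd e)) =
      (\<Sum>e\<in>UNIV. if e = (v, w) then A $ v $ w else 0)" for v w
    by (intro sum.cong) (auto simp: prod_eq_iff)
  thus ?thesis
    by (simp add: vec_eq_iff matrix_matrix_mult_def conj_transpose_def V_incidence_def W_incidence_def)
qed

lemma V_incidence_operator:
  assumes "biregular G (c + 1) (d + 1)"
  shows "incidence_operator V_incidence (conj_transpose V_incidence) edge_proj (real c)"
proof
  have "(\<Sum>e\<in>UNIV. cnj (of_bool (v = fst e \<and> A $ fst e $ snd e \<noteq> 0)) *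
      of_bool (v' = fst e \<and> A $ fst e $ snd e \<noteq> 0)) = (if v = v' then 1 + of_nat c else (0::complex))"
    for v v'
  proof -
    have "(\<Sum>e\<in>UNIV. cnj (of_bool (v = fst e \<and> A $ fst e $ snd e \<noteq> 0)) *
      of_bool (v' = fst e \<and> A $ fst e $ snd e \<noteq> 0)) =
      (\<Sum>e\<in>Pair v ` {w. A $ v $ w \<noteq> 0}. of_bool (v = v') :: complex)"
      by (intro sum.mono_neutral_cong_right) (auto simp: of_bool_def)
    also have "\<dots> = of_nat (card {w. A $ v $ w \<noteq> 0}) * of_bool (v = v')"
      by (simp add: card_image inj_on_def)
    also have "card {w. A $ v $ w \<noteq> 0} = c + 1"
      using assms unfolding biregular_def with_proj_simps arc_iff by simp
    finally show ?thesis by simp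
  qed
  thus "conj_transpose V_incidence ** V_incidence = (real c + 1) *\<^sub>R mat 1"
    unfolding vec_eq_iff matrix_mult_entry scaled_mat_1_entry conj_transpose_def V_incidence_def
    by simp
qed (simp_all only: vec_eq_iff edge_proj_mult, auto simp: V_incidence_def conj_transpose_def edge_proj_def)

lemma W_incidence_operator:
  assumes "biregular G (c + 1) (d + 1)"
  shows "incidence_operator W_incidence (conj_transpose W_incidence) edge_proj (real d)"
proof
  have "(\<Sum>e\<in>UNIV. cnj (of_bool (w = snd e) * A $ fst e $ snd e) *
      (of_bool (w' = snd e) * A $ fst e $ snd e)) = (if w = w' then 1 + of_nat d else 0)"
    for w w'
  proof -
    have "(\<Sum>e\<in>UNIV. cnj (of_bool (w = snd e) * A $ fst e $ snd e) *
      (of_bool (w' = snd e) * A $ fst e $ snd e)) =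
      (\<Sum>e\<in>(\<lambda>v. (v, w)) ` {v. A $ v $ w \<noteq> 0}. of_bool (w = w'))"
      using unit_entries
      by (intro sum.mono_neutral_cong_right) (auto simp: of_bool_def mult.commute)
    also have "\<dots> = of_nat (card {v. A $ v $ w \<noteq> 0}) * of_bool (w = w')"
      by (simp add: card_image inj_on_def)
    also have "card {v. A $ v $ w \<noteq> 0} = d + 1"
      using assms unfolding biregular_def with_proj_simps arc_iff by simp
    finally show ?thesis by simp
  qed
  thus "conj_transpose W_incidence ** W_incidence = (real d + 1) *\<^sub>R mat 1"
    unfolding vec_eq_iff matrix_mult_entry scaled_mat_1_entry conj_transpose_def W_incidence_def
    by simp
qed (simp_all only: vec_eq_iff edge_proj_mult, auto simp: W_incidence_def conj_transpose_def edge_proj_def)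

lemma V_turn_entry:
  assumes "biregular G (c + 1) (d + 1)"
  shows "incidence_operator.turn V_incidence (conj_transpose V_incidence) edge_proj $ e $ f =
    of_bool (fst e = fst f \<and> snd e \<noteq> snd f \<and> A $ fst e $ snd e \<noteq> 0 \<and> A $ fst f $ snd f \<noteq> 0)"
proof -
  interpret V: incidence_operator V_incidence "conj_transpose V_incidence" edge_proj "real c"
    by (rule V_incidence_operator[OF assms])
  have "(V_incidence ** conj_transpose V_incidence) $ e $ f =
    (\<Sum>v\<in>UNIV. if v = fst e
      then of_bool (fst e = fst f \<and> A $ fst e $ snd e \<noteq> 0 \<and> A $ fst f $ snd f \<noteq> 0) else 0)"
    unfolding matrix_mult_entry conj_transpose_def V_incidence_def
    by (intro sum.cong) auto
  thus ?thesis
    by (auto simp: V.turn_def edge_proj_entry prod_eq_iff)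
qed

lemma W_turn_entry:
  assumes "biregular G (c + 1) (d + 1)"
  shows "incidence_operator.turn W_incidence (conj_transpose W_incidence) edge_proj $ e $ f =
    (if snd e = snd f \<and> fst e \<noteq> fst f then A $ fst e $ snd e * cnj (A $ fst f $ snd f) else 0)"
proof -
  interpret W: incidence_operator W_incidence "conj_transpose W_incidence" edge_proj "real d"
    by (rule W_incidence_operator[OF assms])
  have "(W_incidence ** conj_transpose W_incidence) $ e $ f =
    (\<Sum>w\<in>UNIV. if w = snd e
      then of_bool (snd e = snd f) * (A $ fst e $ snd e * cnj (A $ fst f $ snd f)) else 0)"
    unfolding matrix_mult_entry conj_transpose_def W_incidence_def
    by (intro sum.cong) auto
  thus ?thesis
    by (auto simp: W.turn_def edge_proj_entry prod_eq_iff unit_entries)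
qed

text \<open>
  There is only one possible intermediate edge: it has the end in \<open>W\<close> of \<open>e\<close> and the end in
  \<open>V\<close> of \<open>f\<close>.
\<close>

lemma W_turn_V_turn_entry:
  assumes "biregular G (c + 1) (d + 1)"
  defines "a \<equiv> incidence_operator.turn V_incidence (conj_transpose V_incidence) edge_proj"
    and "b \<equiv> incidence_operator.turn W_incidence (conj_transpose W_incidence) edge_proj"
  shows "(b ** a) $ e $ f = (if step e f then A $ fst e $ snd e * cnj (A $ fst f $ snd e) else 0)"
proof -
  have "(b ** a) $ e $ f = (\<Sum>g\<in>UNIV. if g = (fst f, snd e) then
      (if step e f then A $ fst e $ snd e * cnj (A $ fst f $ snd e) else 0) else 0)"
    unfolding matrix_mult_entry a_def b_def V_turn_entry[OF assms(1)] W_turn_entry[OF assms(1)]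
    by (intro sum.cong) (auto simp: step_def prod_eq_iff)
  thus ?thesis by simp
qed

lemma biregular_operators:
  assumes "biregular G (c + 1) (d + 1)" "c \<noteq> 0"
  shows "biregular_operators V_incidence (conj_transpose V_incidence)
    W_incidence (conj_transpose W_incidence) edge_proj (real c) (real d)"
proof -
  interpret V: incidence_operator V_incidence "conj_transpose V_incidence" edge_proj "real c"
    by (rule V_incidence_operator[OF assms(1)])
  interpret W: incidence_operator W_incidence "conj_transpose W_incidence" edge_proj "real d"
    by (rule W_incidence_operator[OF assms(1)])
  show ?thesis
    using assms
    by unfold_locales (simp_all add: trace_def V_turn_entry[OF assms(1)] W_turn_entry[OF assms(1)]
        W_turn_V_turn_entry[OF assms(1)] step_def)
qed

end

section \<open>The trace formula\<close>

lemma conj_transpose_mult: "conj_transpose (A ** B) = conj_transpose B ** conj_transpose A"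
  by (simp add: vec_eq_iff conj_transpose_def matrix_matrix_mult_def mult.commute)

lemma conj_transpose_conj_transpose: "conj_transpose (conj_transpose A) = A"
  by (simp add: vec_eq_iff conj_transpose_def)

theorem theorem2p4:
  fixes c d k :: nat
    and G :: "('v::finite + 'w::finite) pair_pre_digraph"
    and A :: "complex ^ 'w ^ 'v"
  assumes "c \<ge> d" and "d \<ge> 1"
    and "bipartite_graph G" and "biregular G (c + 1) (d + 1)"
    and "gen_adjacency_matrix G A"
    and "k \<ge> 1"
  shows "(\<Sum>\<gamma> \<in> closed_nbt_paths_from_V G (2 * k). A2 A \<gamma>) =
    trace (2 *\<^sub>R poly_matrix (chebyshev_T_tilde c d k) (A ** conj_transpose A) +
           s_const c d k *\<^sub>R mat 1)"
proof -
  interpret generalized_adjacency G A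
    by unfold_locales fact+
  interpret biregular_operators V_incidence "conj_transpose V_incidence"
    W_incidence "conj_transpose W_incidence" edge_proj "real c" "real d"
    using assms by (intro biregular_operators) auto
  have cd: "c * d > 0" using assms by simp
  have M: "M = A ** conj_transpose A"
  proof -
    have "conj_transpose A = conj_transpose W_incidence ** V_incidence"
      by (metis conj_transpose_V_mult_W conj_transpose_mult conj_transpose_conj_transpose)
    thus ?thesis by (simp add: M_def matrix_mul_assoc conj_transpose_V_mult_W)
  qed
  define D where "D k = 2 *\<^sub>R poly_matrix (chebyshev_T_tilde c d k) (A ** conj_transpose A)" for k
  note D = poly_matrix_chebyshev_T_tilde_recursion[OF cd, where M = "A ** conj_transpose A", folded D_def]
  have H: "H = A ** conj_transpose A - real (c + d) *\<^sub>R mat 1"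
    by (simp add: H_def M)
  have "(\<Sum>\<gamma> \<in> closed_nbt_paths_from_V G (2 * k). A2 A \<gamma>) = tau k"
    unfolding tau_def N_def
    by (intro sum_closed_paths_eq_trace W_turn_V_turn_entry[OF assms(4)] assms)
  also have "\<dots> = trace (D k) + s_const c d k *\<^sub>R of_nat CARD('v)"
    using trace_N_power[of D "k - 1"] D assms(6) unfolding H s_const_def by simp
  also have "\<dots> = trace (D k + s_const c d k *\<^sub>R mat 1)"
    by (simp add: trace_add trace_scaleR trace_I)
  finally show ?thesis unfolding D_def .
qed

end
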